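(* A loxodrome $\alpha$ on a rotational surface $R$ in $\mathbb{E}^3$ with a negative constant Gaussian curvature $K_0$ can be parametrized by $$\alpha(t)=\begin{pmatrix}\big(A\cosh(a\sqrt{-K_0}\,t+a_0)+B\sinh(a\sqrt{-K_0}\,t+a_0)\big)\cos\theta(t)\\ \big(A\cosh(a\sqrt{-K_0}\,t+a_0)+B\sinh(a\sqrt{-K_0}\,t+a_0)\big)\sin\theta(t)\\ \pm\displaystyle\int_0^{at+c}\sqrt{1+K_0\big(A\sinh(\sqrt{-K_0}\xi)+B\cosh(\sqrt{-K_0}\xi)\big)^2}\,d\xi\end{pmatrix},$$ where the function $\theta(t)$ is given by one of the following: (i) $\displaystyle\theta(t)=\frac{\varepsilon\tan\psi}{B\sqrt{-K_0}}\ln\left|\tanh\left(\tfrac12(a\sqrt{-K_0}\,t+a_0)\right)\right|+\theta_0$ for $A=0$ and $B\neq0$; (ii) $\displaystyle\theta(t)=\frac{2\varepsilon\tan\psi}{\sqrt{K_0(B^2-A^2)}}\arctan\left(\frac{1}{\sqrt{A^2-B^2}}\left(A\tanh\left(\tfrac12(a\sqrt{-K_0}\,t+a_0)\right)+B\right)\right)+\theta_0$ for $A\neq0$ and $B^2<A^2$; (iii) $\displaystyle\theta(t)=\frac{2\varepsilon\tan\psi}{\sqrt{K_0(A^2-B^2)}}\,\operatorname{arctanh}\left(\frac{1}{\sqrt{B^2-A^2}}\left(A\tanh\left(\tfrac12(a\sqrt{-K_0}\,t+a_0)\right)+B\right)\right)+\theta_0$ for $B\neq0$ and $A^2<B^2$;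 (iv) $\displaystyle\theta(t)=-\frac{\varepsilon\tan\psi}{A\sqrt{-K_0}}e^{-(a\sqrt{-K_0}\,t+a_0)}+\theta_0$ for $A=B\neq0$; and $A,B,a_0,\theta_0$, $a=\cos\psi$ are constants.
   Context: A rotational surface $R$ is given by an immersion $\Phi(s,\theta)=(f(s)\cos\theta,f(s)\sin\theta,g(s))$ with $f'^2+g'^2=1$; its Gaussian curvature is $K=-f''/f$. Meridians are the curves $s\mapsto\Phi(s,\theta)$ with $\theta$ constant. A loxodrome on $R$ is a curve $\alpha(t)=\Phi(s(t),\theta(t))$, parametrized by arc length $t$, which meets the meridians at a constant angle $\psi\in[0,\pi]$. Here $s(t)=at+c$ with $c$ a constant, $f(s)=A\cosh(\sqrt{-K_0}s)+B\sinh(\sqrt{-K_0}s)$ (so $a_0$ arises as $c\sqrt{-K_0}$), and $\varepsilon=\pm1$.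
   Formalization: ψ=π/2 (tan ψ undefined) is excluded; the height has an additive constant, zero if g is normalized at 0; the omitted case A=−B is reduced to (iv) by reversing curve and meridians; arctanh x in (iii) means ½ln|(1+x)/(1−x)|, as |x|>1 can occur. *)

theory Defs
  imports "HOL-Analysis.Analysis"
begin

definition partial1 :: "(real \<times> real \<Rightarrow> 'a::real_normed_vector) \<Rightarrow> real \<times> real \<Rightarrow> 'a" where
  "partial1 X p = vector_derivative (\<lambda>x. X (x, snd p)) (at (fst p))"

definition partial2 :: "(real \<times> real \<Rightarrow> 'a::real_normed_vector) \<Rightarrow> real \<times> real \<Rightarrow> 'a" where
  "partial2 X p = vector_derivative (\<lambda>y. X (fst p, y)) (at (snd p))"

definition immersion_on :: "(real \<times> real) set \<Rightarrow> (real \<times> real \<Rightarrow> real^3) \<Rightarrow> bool" where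
  "immersion_on U X \<longleftrightarrow> (\<forall>p\<in>U. \<exists>D. (X has_derivative D) (at p) \<and> inj D)"

definition unit_normal :: "(real \<times> real \<Rightarrow> real^3) \<Rightarrow> real \<times> real \<Rightarrow> real^3" where
  "unit_normal X p = sgn (cross3 (partial1 X p) (partial2 X p))"

text \<open>Determinant of the second fundamental form over that of the first.\<close>

definition gaussian_curvature :: "(real \<times> real \<Rightarrow> real^3) \<Rightarrow> real \<times> real \<Rightarrow> real" where
  "gaussian_curvature X p =
     ((partial1 (partial1 X) p \<bullet> unit_normal X p) * (partial2 (partial2 X) p \<bullet> unit_normal X p)
        - (partial2 (partial1 X) p \<bullet> unit_normal X p)\<^sup>2) /
     ((partial1 X p \<bullet> partial1 X p) * (partial2 X p \<bullet> partial2 X p)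
        - (partial1 X p \<bullet> partial2 X p)\<^sup>2)"

definition rotation_map :: "(real \<Rightarrow> real) \<Rightarrow> (real \<Rightarrow> real) \<Rightarrow> real \<times> real \<Rightarrow> real^3" where
  "rotation_map f g = (\<lambda>(s, \<theta>). vector [f s * cos \<theta>, f s * sin \<theta>, g s])"

text \<open>The angle \<open>\<theta>\<close> ranges over all of the real line, so the parametrization need not be injective.\<close>

definition rotational_surface :: "(real \<Rightarrow> real) \<Rightarrow> (real \<Rightarrow> real) \<Rightarrow> real set \<Rightarrow> bool" where
  "rotational_surface f g J \<longleftrightarrow>
     open J \<and> is_interval J \<and> J \<noteq> {} \<and>
     f differentiable_on J \<and> deriv f differentiable_on J \<and>
     g differentiable_on J \<and> deriv g differentiable_on J \<and>
     (\<forall>s\<in>J. (deriv f s)\<^sup>2 + (deriv g s)\<^sup>2 = 1) \<and>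
     immersion_on (J \<times> UNIV) (rotation_map f g)"

definition vec_angle :: "'a::real_inner \<Rightarrow> 'a \<Rightarrow> real" where
  "vec_angle u v = arccos (u \<bullet> v / (norm u * norm v))"

text \<open>The meridian through \<open>\<alpha> t\<close> is oriented by increasing \<open>s\<close>; its tangent is the first
  partial derivative of the parametrization.\<close>

definition loxodrome ::
    "(real \<Rightarrow> real) \<Rightarrow> (real \<Rightarrow> real) \<Rightarrow> real set \<Rightarrow> real set \<Rightarrow> real \<Rightarrow> (real \<Rightarrow> real^3) \<Rightarrow> bool" where
  "loxodrome f g J I \<psi> \<alpha> \<longleftrightarrow>
     open I \<and> is_interval I \<and> I \<noteq> {} \<and> 0 \<le> \<psi> \<and> \<psi> \<le> pi \<and>
     (\<exists>s \<theta>. s differentiable_on I \<and> \<theta> differentiable_on I \<and> s ` I \<subseteq> J \<and>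
        (\<forall>t\<in>I. \<alpha> t = rotation_map f g (s t, \<theta> t) \<and>
               norm (vector_derivative \<alpha> (at t)) = 1 \<and>
               vec_angle (vector_derivative \<alpha> (at t))
                 (partial1 (rotation_map f g) (s t, \<theta> t)) = \<psi>))"

lemma has_vector_derivative_vector_3:
  fixes a b c :: "real \<Rightarrow> real"
  assumes "(a has_real_derivative a') (at x)" "(b has_real_derivative b') (at x)"
    "(c has_real_derivative c') (at x)"
  shows "((\<lambda>x. vector [a x, b x, c x] :: real^3) has_vector_derivative vector [a', b', c']) (at x)"
proof -
  have eq: "(vector [u, v, w] :: real^3) = u *\<^sub>R axis 1 1 + v *\<^sub>R axis 2 1 + w *\<^sub>R axis 3 1" for u v w
    by (simp add: vec_eq_iff forall_3 axis_def)
  show ?thesis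
    unfolding eq using assms by (auto intro!: derivative_eq_intros)
qed

lemma partial_rotation_map:
  assumes "rotational_surface f g J" "s \<in> J"
  shows "partial1 (rotation_map f g) (s, \<theta>) = vector [deriv f s * cos \<theta>, deriv f s * sin \<theta>, deriv g s]"
    and "partial2 (rotation_map f g) (s, \<theta>) = vector [- f s * sin \<theta>, f s * cos \<theta>, 0]"
    and "partial1 (partial1 (rotation_map f g)) (s, \<theta>) =
           vector [deriv (deriv f) s * cos \<theta>, deriv (deriv f) s * sin \<theta>, deriv (deriv g) s]"
    and "partial2 (partial1 (rotation_map f g)) (s, \<theta>) = vector [- deriv f s * sin \<theta>, deriv f s * cos \<theta>, 0]"
    and "partial2 (partial2 (rotation_map f g)) (s, \<theta>) = vector [- f s * cos \<theta>, - f s * sin \<theta>, 0]"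
proof -
  have J: "open J"
    using assms by (simp add: rotational_surface_def)
  have D: "(h has_real_derivative deriv h x) (at x)" if "h differentiable_on J" "x \<in> J" for h x
    using that J by (metis DERIV_deriv_iff_real_differentiable at_within_open differentiable_on_def)
  have d: "(f has_real_derivative deriv f x) (at x)" "(g has_real_derivative deriv g x) (at x)"
    "(deriv f has_real_derivative deriv (deriv f) x) (at x)"
    "(deriv g has_real_derivative deriv (deriv g) x) (at x)" if "x \<in> J" for x
    using assms that by (auto simp: rotational_surface_def intro!: D)
  have 1: "partial1 (rotation_map f g) (x, \<theta>) = vector [deriv f x * cos \<theta>, deriv f x * sin \<theta>, deriv g x]"
    if "x \<in> J" for x \<theta>
    unfolding partial1_def rotation_map_def prod.case fst_conv snd_conv
    by (rule vector_derivative_at, rule has_vector_derivative_vector_3)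
      (auto intro!: derivative_eq_intros d that)
  have 2: "partial2 (rotation_map f g) (x, \<theta>) = vector [- f x * sin \<theta>, f x * cos \<theta>, 0]" for x \<theta>
    unfolding partial2_def rotation_map_def prod.case fst_conv snd_conv
    by (rule vector_derivative_at, rule has_vector_derivative_vector_3)
      (auto intro!: derivative_eq_intros)
  show "partial1 (rotation_map f g) (s, \<theta>) = vector [deriv f s * cos \<theta>, deriv f s * sin \<theta>, deriv g s]"
    using 1 assms by blast
  show "partial2 (rotation_map f g) (s, \<theta>) = vector [- f s * sin \<theta>, f s * cos \<theta>, 0]"
    by (rule 2)
  have "((\<lambda>x. vector [deriv f x * cos \<theta>, deriv f x * sin \<theta>, deriv g x] :: real^3) has_vector_derivative
      vector [deriv (deriv f) s * cos \<theta>, deriv (deriv f) s * sin \<theta>, deriv (deriv g) s]) (at s)"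
    by (rule has_vector_derivative_vector_3) (auto intro!: derivative_eq_intros d assms)
  then have "((\<lambda>x. partial1 (rotation_map f g) (x, \<theta>)) has_vector_derivative
      vector [deriv (deriv f) s * cos \<theta>, deriv (deriv f) s * sin \<theta>, deriv (deriv g) s]) (at s)"
    by (rule has_vector_derivative_transform_within_open[OF _ J]) (auto simp: 1 assms)
  then show "partial1 (partial1 (rotation_map f g)) (s, \<theta>) =
           vector [deriv (deriv f) s * cos \<theta>, deriv (deriv f) s * sin \<theta>, deriv (deriv g) s]"
    unfolding partial1_def[of "partial1 _"] fst_conv snd_conv by (rule vector_derivative_at)
  show "partial2 (partial1 (rotation_map f g)) (s, \<theta>) = vector [- deriv f s * sin \<theta>, deriv f s * cos \<theta>, 0]"
    unfolding partial2_def fst_conv snd_conv 1[OF assms(2)]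
    by (rule vector_derivative_at, rule has_vector_derivative_vector_3)
      (auto intro!: derivative_eq_intros)
  show "partial2 (partial2 (rotation_map f g)) (s, \<theta>) = vector [- f s * cos \<theta>, - f s * sin \<theta>, 0]"
    unfolding partial2_def[of "partial2 _"] fst_conv snd_conv 2
    by (rule vector_derivative_at, rule has_vector_derivative_vector_3)
      (auto intro!: derivative_eq_intros)
qed

lemma rotational_surface_radius_nonzero:
  assumes "rotational_surface f g J" "s \<in> J"
  shows "f s \<noteq> 0"
proof
  assume f0: "f s = 0"
  obtain D where D: "(rotation_map f g has_derivative D) (at (s, 0))" "inj D"
    using assms unfolding rotational_surface_def immersion_on_def by blast
  have "((\<lambda>y::real. (s, y)) has_derivative (\<lambda>h. (0, h))) (at 0)"
    by (auto intro!: derivative_eq_intros)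
  from has_derivative_compose[OF this D(1)]
  have "((\<lambda>y. rotation_map f g (s, y)) has_derivative (\<lambda>h. D (0, h))) (at 0)" .
  moreover have "(\<lambda>y. rotation_map f g (s, y)) = (\<lambda>y. vector [0, 0, g s])"
    by (simp add: rotation_map_def f0)
  ultimately have "(\<lambda>h. D (0, h)) = (\<lambda>h. 0)"
    by (metis has_derivative_const has_derivative_unique)
  then have "D (0, 1) = D (0, 0)"
    by metis
  then show False
    using D(2) by (simp add: inj_eq)
qed

text \<open>For a rotational surface the general definition of curvature reduces to \<open>-f''/f\<close>.\<close>

lemma gaussian_curvature_rotation_map:
  assumes "rotational_surface f g J" "s \<in> J"
  shows "gaussian_curvature (rotation_map f g) (s, \<theta>) = - deriv (deriv f) s / f s"
proof -
  have J: "open J"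
    using assms by (simp add: rotational_surface_def)
  note f0 = rotational_surface_radius_nonzero[OF assms]
  define F1 F2 G1 G2 where defs: "F1 = deriv f s" "F2 = deriv (deriv f) s" "G1 = deriv g s"
    "G2 = deriv (deriv g) s"
  have unit: "F1\<^sup>2 + G1\<^sup>2 = 1"
    using assms by (simp add: rotational_surface_def defs)
  have D: "(h has_real_derivative deriv h s) (at s)" if "h differentiable_on J" for h
    using that J assms(2) by (metis DERIV_deriv_iff_real_differentiable at_within_open differentiable_on_def)
  have "(deriv f has_real_derivative F2) (at s)" "(deriv g has_real_derivative G2) (at s)"
    using assms by (auto simp: rotational_surface_def defs intro!: D)
  then have "((\<lambda>x. (deriv f x)\<^sup>2 + (deriv g x)\<^sup>2) has_real_derivative 2 * F1 * F2 + 2 * G1 * G2) (at s)"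
    by (auto intro!: derivative_eq_intros simp: defs)
  moreover have "((\<lambda>x. (deriv f x)\<^sup>2 + (deriv g x)\<^sup>2) has_real_derivative 0) (at s)"
    by (rule has_field_derivative_transform_within_open[OF DERIV_const J assms(2), of 1])
      (use assms in \<open>auto simp: rotational_surface_def\<close>)
  ultimately have "2 * F1 * F2 + 2 * G1 * G2 = 0"
    by (rule DERIV_unique)
  then have orth: "G1 * G2 = - F1 * F2" by simp
  have cs: "(sin \<theta>)\<^sup>2 = 1 - (cos \<theta>)\<^sup>2"
    by (simp add: sin_squared_eq)
  define w :: "real^3" where "w = vector [- G1 * cos \<theta>, - G1 * sin \<theta>, F1]"
  have w: "w \<bullet> w = 1"
    using unit cs unfolding w_def inner_vec_def sum_3 by (simp; algebra)
  have "cross3 (partial1 (rotation_map f g) (s, \<theta>)) (partial2 (rotation_map f g) (s, \<theta>)) = f s *\<^sub>R w"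
    unfolding partial_rotation_map[OF assms] defs[symmetric] w_def vec_eq_iff forall_3 cross3_def
    using cs by (simp; algebra)
  then have n: "unit_normal (rotation_map f g) (s, \<theta>) = sgn (f s) *\<^sub>R w"
    using w by (simp add: unit_normal_def sgn_scaleR sgn_div_norm norm_eq_sqrt_inner)
  have L: "partial1 (partial1 (rotation_map f g)) (s, \<theta>) \<bullet> w = F1 * G2 - F2 * G1"
    unfolding partial_rotation_map[OF assms] defs[symmetric] w_def inner_vec_def sum_3
    using cs by (simp; algebra)
  have M: "partial2 (partial1 (rotation_map f g)) (s, \<theta>) \<bullet> w = 0"
    unfolding partial_rotation_map[OF assms] defs[symmetric] w_def inner_vec_def sum_3
    by simp
  have N: "partial2 (partial2 (rotation_map f g)) (s, \<theta>) \<bullet> w = f s * G1"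
    unfolding partial_rotation_map[OF assms] defs[symmetric] w_def inner_vec_def sum_3
    using cs by (simp; algebra)
  have E: "partial1 (rotation_map f g) (s, \<theta>) \<bullet> partial1 (rotation_map f g) (s, \<theta>) = 1"
    unfolding partial_rotation_map[OF assms] defs[symmetric] inner_vec_def sum_3
    using cs unit by (simp; algebra)
  have F: "partial1 (rotation_map f g) (s, \<theta>) \<bullet> partial2 (rotation_map f g) (s, \<theta>) = 0"
    unfolding partial_rotation_map[OF assms] defs[symmetric] inner_vec_def sum_3
    by simp
  have G: "partial2 (rotation_map f g) (s, \<theta>) \<bullet> partial2 (rotation_map f g) (s, \<theta>) = (f s)\<^sup>2"
    unfolding partial_rotation_map[OF assms] defs[symmetric] inner_vec_def sum_3
    using cs by (simp; algebra)
  have "sgn (f s) * sgn (f s) = 1"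
    using f0 by (simp add: sgn_if)
  then have "sgn (f s) * (F1 * G2 - F2 * G1) * (sgn (f s) * (f s * G1)) = (F1 * G2 - F2 * G1) * (f s * G1)"
    by algebra
  also have "\<dots> = - F2 * f s"
    using orth unit by algebra
  finally have "gaussian_curvature (rotation_map f g) (s, \<theta>) = - F2 * f s / (f s)\<^sup>2"
    unfolding gaussian_curvature_def n inner_scaleR_right L M N E F G by simp
  then show ?thesis
    using f0 by (simp add: defs power2_eq_square)
qed

text \<open>On the reals \<open>ln\<close> satisfies \<open>ln (-x) = ln x\<close>, so outside \<open>[-1,1]\<close> the function \<open>artanh\<close> takes
  the value \<open>arcoth x\<close>, the real part of the complex inverse hyperbolic tangent.\<close>

lemma artanh_real_conv_ln_abs: "artanh x = ln \<bar>(1 + x) / (1 - x)\<bar> / 2" for x :: real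
  by (simp add: artanh_def abs_if ln_minus)

end

theory Submission
  imports Defs
begin

text \<open>
  Put \<open>k = sqrt (- K\<^sub>0)\<close>. Constant curvature means \<open>f'' = k\<^sup>2 f\<close>, so \<open>f\<close> is a combination of
  \<open>cosh (k s)\<close> and \<open>sinh (k s)\<close>; since \<open>g'\<close> never vanishes, \<open>g\<close> is up to a sign and a constant
  the integral of \<open>sqrt (1 - f'\<^sup>2)\<close>. As the meridians have unit speed and are orthogonal to the
  parallels, a loxodrome satisfies \<open>s' = cos \<psi>\<close> and \<open>(\<theta>' f)\<^sup>2 = sin\<^sup>2 \<psi>\<close>. Hence \<open>s\<close> is affine,
  \<open>\<theta>' f\<close> has a constant sign, and \<open>d\<theta>/ds = \<plusminus> tan \<psi> / f\<close>; the four formulas are the primitives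
  of \<open>1 / f\<close> obtained from the substitution \<open>u = tanh (k s / 2)\<close>.
\<close>

lemma derivative_sign_change_zero:
  fixes h h' :: "real \<Rightarrow> real"
  assumes D: "\<And>z. x \<le> z \<Longrightarrow> z \<le> y \<Longrightarrow> (h has_real_derivative h' z) (at z)"
    and xy: "x < y" and sgn: "h' x < 0" "0 < h' y"
  shows "\<exists>z. x < z \<and> z < y \<and> h' z = 0"
proof -
  have "continuous_on {x..y} h"
    using D by (meson DERIV_atLeastAtMost_imp_continuous_on)
  then obtain z where z: "z \<in> {x..y}" and min: "\<And>w. w \<in> {x..y} \<Longrightarrow> h z \<le> h w"
    using continuous_attains_inf[of "{x..y}" h] xy by auto
  have "z \<noteq> x"
  proof
    assume "z = x"
    obtain d where "d > 0" "\<And>e. 0 < e \<Longrightarrow> e < d \<Longrightarrow> h (x + e) < h x"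
      using DERIV_neg_dec_right[OF D[of x] sgn(1)] xy by auto
    then have "h (x + min (d/2) (y - x)) < h x"
      using xy by (auto simp: min_def)
    then show False
      using min[of "x + min (d/2) (y - x)"] \<open>z = x\<close> \<open>d > 0\<close> xy by (auto simp: min_def split: if_splits)
  qed
  moreover have "z \<noteq> y"
  proof
    assume "z = y"
    obtain d where "d > 0" "\<And>e. 0 < e \<Longrightarrow> e < d \<Longrightarrow> h (y - e) < h y"
      using DERIV_pos_inc_left[OF D[of y] sgn(2)] xy by auto
    then have "h (y - min (d/2) (y - x)) < h y"
      using xy by (auto simp: min_def)
    then show False
      using min[of "y - min (d/2) (y - x)"] \<open>z = y\<close> \<open>d > 0\<close> xy by (auto simp: min_def split: if_splits)
  qed
  ultimately have z': "x < z" "z < y" using z by auto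
  have "h' z = 0"
    by (rule DERIV_local_min[OF D, where d = "min (z - x) (y - z)"]) (use z' in \<open>auto intro!: min\<close>)
  with z' show ?thesis by blast
qed

text \<open>The angle function is only assumed differentiable, so its derivative need not be continuous:
  a constant sign comes from Darboux's intermediate value property of derivatives.\<close>

lemma nonzero_derivative_constant_sign:
  fixes h h' :: "real \<Rightarrow> real"
  assumes I: "is_interval I"
    and D: "\<And>x. x \<in> I \<Longrightarrow> (h has_real_derivative h' x) (at x)"
    and nz: "\<And>x. x \<in> I \<Longrightarrow> h' x \<noteq> 0"
  shows "\<exists>\<sigma>\<in>{1, -1}. \<forall>x\<in>I. h' x = \<sigma> * \<bar>h' x\<bar>"
proof (rule ccontr)
  assume "\<not> ?thesis"
  then obtain x y where xy: "x \<in> I" "y \<in> I" "h' x < 0" "h' y > 0"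
    using nz by (fastforce simp: abs_if split: if_splits)
  have mem: "z \<in> I" if "min x y \<le> z" "z \<le> max x y" for z
    using that xy I by (metis is_interval_1 max_def min_def)
  consider "x < y" | "y < x" using xy by force
  then show False
  proof cases
    case 1
    then show False
      using derivative_sign_change_zero[of x y h h'] D nz mem xy by force
  next
    case 2
    have "\<exists>z. y < z \<and> z < x \<and> - h' z = 0"
      using 2 mem xy by (intro derivative_sign_change_zero[of y x "\<lambda>z. - h z"]) (auto intro!: DERIV_minus D)
    then show False
      using 2 nz mem by force
  qed
qed

lemma hyperbolic_ode_solution:
  fixes f f' :: "real \<Rightarrow> real"
  assumes J: "is_interval J" and k: "k \<noteq> 0"
    and D: "\<And>s. s \<in> J \<Longrightarrow> (f has_real_derivative f' s) (at s)"
    and D': "\<And>s. s \<in> J \<Longrightarrow> (f' has_real_derivative k\<^sup>2 * f s) (at s)"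
  shows "\<exists>A B. \<forall>s\<in>J. f s = A * cosh (k * s) + B * sinh (k * s)"
proof -
  have conv: "convex J" using J by (simp add: is_interval_convex_1)
  have "\<exists>A. \<forall>s\<in>J. k * f s * cosh (k * s) - f' s * sinh (k * s) = A"
    by (rule has_field_derivative_zero_constant[OF conv], rule has_field_derivative_at_within)
      (auto intro!: derivative_eq_intros D D' simp: power2_eq_square algebra_simps)
  then obtain A where A: "\<And>s. s \<in> J \<Longrightarrow> A = k * f s * cosh (k * s) - f' s * sinh (k * s)"
    by metis
  have "\<exists>B. \<forall>s\<in>J. f' s * cosh (k * s) - k * f s * sinh (k * s) = B"
    by (rule has_field_derivative_zero_constant[OF conv], rule has_field_derivative_at_within)
      (auto intro!: derivative_eq_intros D D' simp: power2_eq_square algebra_simps)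
  then obtain B where B: "\<And>s. s \<in> J \<Longrightarrow> B = f' s * cosh (k * s) - k * f s * sinh (k * s)"
    by metis
  have "f s = A / k * cosh (k * s) + B / k * sinh (k * s)" if "s \<in> J" for s
  proof -
    have "A * cosh (k * s) + B * sinh (k * s) = k * f s * ((cosh (k * s))\<^sup>2 - (sinh (k * s))\<^sup>2)"
      unfolding A[OF that] B[OF that] by algebra
    then show ?thesis
      using k by (simp add: hyperbolic_pythagoras field_simps)
  qed
  then show ?thesis by blast
qed

lemma has_real_derivative_ln_abs:
  assumes "x \<noteq> 0"
  shows "((\<lambda>x. ln \<bar>x\<bar>) has_real_derivative 1 / x) (at x)"
proof -
  have "(\<lambda>y. ln \<bar>y\<bar>) = (\<lambda>y. ln (sgn x * y))"
    using assms by (auto simp: abs_if ln_minus sgn_if)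
  moreover have "((\<lambda>y. ln (sgn x * y)) has_real_derivative 1 / (sgn x * x) * sgn x) (at x)"
    by (rule DERIV_chain2[OF DERIV_ln_divide]) (use assms in \<open>auto simp: sgn_if intro!: derivative_eq_intros\<close>)
  ultimately show ?thesis
    using assms by (simp add: sgn_if split: if_splits)
qed

lemma has_real_derivative_artanh:
  fixes x :: real
  assumes "x\<^sup>2 \<noteq> 1"
  shows "(artanh has_real_derivative 1 / (1 - x\<^sup>2)) (at x)"
proof -
  have nz: "1 + x \<noteq> 0" "1 - x \<noteq> 0"
    using assms by (auto simp: power2_eq_1_iff)
  have sq: "1 - x\<^sup>2 = (1 + x) * (1 - x)"
    by algebra
  have "((\<lambda>x. (1 + x) / (1 - x)) has_real_derivative 2 / (1 - x)\<^sup>2) (at x)"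
    using nz by (auto intro!: derivative_eq_intros simp: power2_eq_square field_simps)
  from DERIV_chain2[OF has_real_derivative_ln_abs this]
  have "((\<lambda>x. ln \<bar>(1 + x) / (1 - x)\<bar>) has_real_derivative 1 / ((1 + x) / (1 - x)) * (2 / (1 - x)\<^sup>2)) (at x)"
    using nz by simp
  moreover have "1 / ((1 + x) / (1 - x)) * (2 / (1 - x)\<^sup>2) = 2 * (1 / (1 - x\<^sup>2))"
    unfolding sq using nz by (simp add: power2_eq_square[of "1 - x"] divide_simps)
  ultimately have "((\<lambda>x. ln \<bar>(1 + x) / (1 - x)\<bar>) has_real_derivative 2 * (1 / (1 - x\<^sup>2))) (at x)"
    by simp
  from DERIV_cdivide[OF this, of 2] show ?thesis
    unfolding artanh_real_conv_ln_abs[abs_def] by (simp only: nonzero_mult_div_cancel_left zero_neq_numeral[symmetric] not_False_eq_True)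
qed

lemma one_minus_tanh_square_pos: "1 - (tanh x)\<^sup>2 > 0" for x :: real
  using tanh_real_bounds[of x] by (simp add: abs_square_less_1 abs_less_iff)

lemma cosh_sinh_half_angle:
  fixes x :: real
  shows "(A * cosh x + B * sinh x) * (1 - (tanh (x / 2))\<^sup>2) =
    A * (1 + (tanh (x / 2))\<^sup>2) + 2 * B * tanh (x / 2)"
proof -
  define C S where CS: "C = cosh (x / 2)" "S = sinh (x / 2)"
  have C: "C \<noteq> 0" and p: "C\<^sup>2 - S\<^sup>2 = 1"
    using hyperbolic_pythagoras[of "x / 2"] by (simp_all add: CS)
  have c: "cosh x = C\<^sup>2 + S\<^sup>2" and s: "sinh x = 2 * S * C"
    using cosh_add[of "x/2" "x/2"] sinh_add[of "x/2" "x/2"] by (simp_all add: power2_eq_square CS)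
  have t: "tanh (x / 2) * C = S"
    using C by (simp add: tanh_def CS)
  have "1 - (tanh (x / 2))\<^sup>2 = 1 / C\<^sup>2"
    using C p unfolding t[symmetric] by (simp add: field_simps)
  moreover have "A * (1 + (tanh (x / 2))\<^sup>2) + 2 * B * tanh (x / 2) = (A * (C\<^sup>2 + S\<^sup>2) + B * (2 * S * C)) / C\<^sup>2"
    using C unfolding t[symmetric] by (simp add: field_simps power2_eq_square)
  ultimately show ?thesis
    by (simp add: c s)
qed

lemma tanh_half_derivative:
  "((\<lambda>s. tanh (1 / 2 * (k * s))) has_real_derivative k / 2 * (1 - (tanh (k * s / 2))\<^sup>2)) (at s)"
  by (auto intro!: derivative_eq_intros)

lemma primitive_recip_sinh:
  assumes "k \<noteq> 0" "B * sinh (k * s) \<noteq> 0"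
  shows "((\<lambda>s. 1 / (B * k) * ln \<bar>tanh (1 / 2 * (k * s))\<bar>) has_real_derivative
    1 / (B * sinh (k * s))) (at s)"
proof -
  define T where "T = tanh (k * s / 2)"
  have half: "B * sinh (k * s) * (1 - T\<^sup>2) = 2 * B * T" and pos: "1 - T\<^sup>2 > 0"
    using cosh_sinh_half_angle[of 0 "k * s" B] one_minus_tanh_square_pos by (simp_all add: T_def)
  have "T \<noteq> 0" using half pos assms by auto
  then have "((\<lambda>s. ln \<bar>tanh (1 / 2 * (k * s))\<bar>) has_real_derivative 1 / T * (k / 2 * (1 - T\<^sup>2))) (at s)"
    using DERIV_chain2[OF has_real_derivative_ln_abs tanh_half_derivative[of k s]] by (simp add: T_def)
  moreover have "1 - T\<^sup>2 = 2 * T / sinh (k * s)"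
  proof -
    have "B * (sinh (k * s) * (1 - T\<^sup>2)) = B * (2 * T)" using half by algebra
    then show ?thesis using assms by (simp add: eq_divide_eq mult.commute)
  qed
  ultimately have "((\<lambda>s. ln \<bar>tanh (1 / 2 * (k * s))\<bar>) has_real_derivative k / sinh (k * s)) (at s)"
    using \<open>T \<noteq> 0\<close> by simp
  from DERIV_cmult[OF this, of "1 / (B * k)"] show ?thesis
    by (rule DERIV_cong) (use assms in simp)
qed

text \<open>The Weierstrass substitution \<open>v = (A tanh (k s / 2) + B) / D\<close>, where \<open>G\<close> is a primitive
  of \<open>1 / (1 \<plusminus> v\<^sup>2)\<close> and \<open>w\<close> its derivative.\<close>

lemma half_angle_substitution:
  fixes G :: "real \<Rightarrow> real" and k :: real
  defines "T \<equiv> \<lambda>s. tanh (k * s / 2)"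
  assumes G: "(G has_real_derivative w) (at (1 / D * (A * T s + B)))"
    and w: "w * (A * (A * (1 + (T s)\<^sup>2) + 2 * B * T s)) = \<eta> * D\<^sup>2"
    and nz: "k \<noteq> 0" "D \<noteq> 0" "A * cosh (k * s) + B * sinh (k * s) \<noteq> 0"
  shows "((\<lambda>s. 2 / (k * D) * G (1 / D * (A * tanh (1 / 2 * (k * s)) + B))) has_real_derivative
    \<eta> / (A * cosh (k * s) + B * sinh (k * s))) (at s)"
proof -
  define R q where "R = A * cosh (k * s) + B * sinh (k * s)" and "q = 1 - (T s)\<^sup>2"
  have "w * (A * (R * q)) = \<eta> * D\<^sup>2"
    using w cosh_sinh_half_angle[of A "k * s" B] by (simp add: R_def q_def T_def)
  then have eq: "w * A * q / D\<^sup>2 = \<eta> / R"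
    using nz by (simp add: frac_eq_eq R_def[symmetric] ac_simps)
  have "(T has_real_derivative k / 2 * q) (at s)"
    using tanh_half_derivative[of k s] by (simp add: T_def[abs_def] q_def)
  then have "((\<lambda>s. 1 / D * (A * T s + B)) has_real_derivative 1 / D * (A * (k / 2 * q) + 0)) (at s)"
    by (intro DERIV_cmult DERIV_add DERIV_const)
  from DERIV_cmult[OF DERIV_chain2[OF G this], of "2 / (k * D)"]
  have "((\<lambda>s. 2 / (k * D) * G (1 / D * (A * T s + B))) has_real_derivative w * A * q / D\<^sup>2) (at s)"
    by (rule DERIV_cong) (use nz in \<open>simp add: power2_eq_square\<close>)
  then show ?thesis
    unfolding eq by (simp add: R_def T_def)
qed

lemma primitive_recip_arctan:
  assumes "k \<noteq> 0" "B\<^sup>2 < A\<^sup>2" "A * cosh (k * s) + B * sinh (k * s) \<noteq> 0"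
  shows "((\<lambda>s. 2 / (k * sqrt (A\<^sup>2 - B\<^sup>2)) *
      arctan (1 / sqrt (A\<^sup>2 - B\<^sup>2) * (A * tanh (1 / 2 * (k * s)) + B))) has_real_derivative
    1 / (A * cosh (k * s) + B * sinh (k * s))) (at s)"
proof (rule half_angle_substitution[OF DERIV_arctan])
  define D T where "D = sqrt (A\<^sup>2 - B\<^sup>2)" and "T = tanh (k * s / 2)"
  have D: "D \<noteq> 0" "D\<^sup>2 = A\<^sup>2 - B\<^sup>2"
    using assms by (simp_all add: D_def)
  define v where "v = 1 / D * (A * T + B)"
  have "v * D = A * T + B"
    using D by (simp add: v_def)
  then have "(1 + v\<^sup>2) * D\<^sup>2 = A * (A * (1 + T\<^sup>2) + 2 * B * T)"
    using D by algebra
  moreover have "1 + v\<^sup>2 \<noteq> 0"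
    by (metis add_pos_nonneg less_irrefl zero_le_power2 zero_less_one)
  ultimately have "inverse (1 + v\<^sup>2) * (A * (A * (1 + T\<^sup>2) + 2 * B * T)) = 1 * D\<^sup>2"
    by (metis left_inverse mult.assoc)
  then show "inverse (1 + (1 / sqrt (A\<^sup>2 - B\<^sup>2) * (A * tanh (k * s / 2) + B))\<^sup>2) *
      (A * (A * (1 + (tanh (k * s / 2))\<^sup>2) + 2 * B * tanh (k * s / 2))) = 1 * (sqrt (A\<^sup>2 - B\<^sup>2))\<^sup>2"
    unfolding v_def D_def T_def .
qed (use assms in auto)

lemma primitive_recip_artanh:
  assumes "k \<noteq> 0" "A \<noteq> 0" "A\<^sup>2 < B\<^sup>2" "A * cosh (k * s) + B * sinh (k * s) \<noteq> 0"
  shows "((\<lambda>s. 2 / (k * sqrt (B\<^sup>2 - A\<^sup>2)) *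
      artanh (1 / sqrt (B\<^sup>2 - A\<^sup>2) * (A * tanh (1 / 2 * (k * s)) + B))) has_real_derivative
    - 1 / (A * cosh (k * s) + B * sinh (k * s))) (at s)"
proof -
  define D T where "D = sqrt (B\<^sup>2 - A\<^sup>2)" and "T = tanh (k * s / 2)"
  have D: "D \<noteq> 0" "D\<^sup>2 = B\<^sup>2 - A\<^sup>2"
    using assms by (simp_all add: D_def)
  define v where "v = 1 / D * (A * T + B)"
  have "v * D = A * T + B"
    using D by (simp add: v_def)
  then have v: "(1 - v\<^sup>2) * D\<^sup>2 = - (A * (A * (1 + T\<^sup>2) + 2 * B * T))"
    using D by algebra
  moreover have "A * (1 + T\<^sup>2) + 2 * B * T \<noteq> 0"
    using cosh_sinh_half_angle[of A "k * s" B] one_minus_tanh_square_pos[of "k * s / 2"] assms(4)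
    unfolding T_def by (metis less_irrefl mult_eq_0_iff)
  ultimately have nz: "1 - v\<^sup>2 \<noteq> 0"
    using assms(2) by auto
  then have "1 / (1 - v\<^sup>2) * (A * (A * (1 + T\<^sup>2) + 2 * B * T)) = - 1 * D\<^sup>2"
    using v by (simp add: divide_eq_eq mult.commute)
  moreover have "(artanh has_real_derivative 1 / (1 - v\<^sup>2)) (at v)"
    using nz by (intro has_real_derivative_artanh) auto
  ultimately show ?thesis
    using half_angle_substitution[of artanh "1 / (1 - v\<^sup>2)" D A k s B "- 1"] assms(1,4) D(1)
    unfolding v_def D_def T_def by blast
qed

lemma primitive_recip_exp:
  assumes "k \<noteq> 0" "A \<noteq> 0"
  shows "((\<lambda>s. - (1 / (A * k)) * exp (- (k * s))) has_real_derivative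
    1 / (A * cosh (k * s) + A * sinh (k * s))) (at s)"
proof -
  have e: "A * cosh (k * s) + A * sinh (k * s) = A * exp (k * s)"
    by (simp flip: distrib_left add: cosh_plus_sinh)
  show ?thesis unfolding e using assms
    by (auto intro!: derivative_eq_intros simp: exp_minus field_simps)
qed

lemma interval_integral_derivative:
  fixes h :: "real \<Rightarrow> real"
  assumes "continuous_on UNIV h"
  shows "((\<lambda>u. LBINT y=0..u. h y) has_real_derivative h x) (at x)"
proof -
  let ?r = "\<bar>x\<bar> + 1"
  have "((\<lambda>u. LBINT y=(0::real)..u. h y) has_vector_derivative h x) (at x within {-?r..?r})"
    using assms by (intro interval_integral_FTC2) (auto intro: continuous_on_subset)
  moreover have "x \<in> interior {-?r..?r}" by (auto simp: abs_if)
  ultimately have "((\<lambda>u. LBINT y=(0::real)..u. h y) has_vector_derivative h x) (at x)"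
    by (simp only: at_within_interior)
  then show ?thesis by (simp add: has_real_derivative_iff_has_vector_derivative zero_ereal_def)
qed

lemma has_real_derivative_deriv_on_open:
  assumes "h differentiable_on J" "open J" "x \<in> J"
  shows "(h has_real_derivative deriv h x) (at x)"
  using assms by (metis DERIV_deriv_iff_real_differentiable at_within_open differentiable_on_def)

lemma negative_curvature_profile:
  assumes surf: "rotational_surface f g J" and K: "K < 0"
    and curv: "\<forall>p \<in> J \<times> UNIV. gaussian_curvature (rotation_map f g) p = K"
  shows "\<exists>A B. \<exists>\<sigma>\<in>{1, -1}. \<forall>s\<in>J.
    f s = A * cosh (sqrt (- K) * s) + B * sinh (sqrt (- K) * s) \<and>
    (g has_real_derivative
      \<sigma> * sqrt (1 + K * (A * sinh (sqrt (- K) * s) + B * cosh (sqrt (- K) * s))\<^sup>2)) (at s)"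
proof -
  define k where "k = sqrt (- K)"
  have k: "k \<noteq> 0" "k\<^sup>2 = - K" using K by (simp_all add: k_def)
  have J: "open J" "is_interval J" and unit: "\<And>s. s \<in> J \<Longrightarrow> (deriv f s)\<^sup>2 + (deriv g s)\<^sup>2 = 1"
    using surf by (simp_all add: rotational_surface_def)
  have f0: "\<And>s. s \<in> J \<Longrightarrow> f s \<noteq> 0"
    using rotational_surface_radius_nonzero[OF surf] .
  have Df: "\<And>s. s \<in> J \<Longrightarrow> (f has_real_derivative deriv f s) (at s)"
    and Dg: "\<And>s. s \<in> J \<Longrightarrow> (g has_real_derivative deriv g s) (at s)"
    and Df': "\<And>s. s \<in> J \<Longrightarrow> (deriv f has_real_derivative deriv (deriv f) s) (at s)"
    and Dg': "\<And>s. s \<in> J \<Longrightarrow> (deriv g has_real_derivative deriv (deriv g) s) (at s)"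
    using surf by (auto simp: rotational_surface_def intro!: has_real_derivative_deriv_on_open)
  have f2: "deriv (deriv f) s = k\<^sup>2 * f s" if "s \<in> J" for s
    using gaussian_curvature_rotation_map[OF surf that, of 0] curv that f0[OF that] k(2)
    by (simp add: field_simps)
  obtain A B where f: "\<And>s. s \<in> J \<Longrightarrow> f s = A * cosh (k * s) + B * sinh (k * s)"
    using hyperbolic_ode_solution[OF J(2) k(1), of f "deriv f"] Df Df' f2 by metis
  have f1: "deriv f s = k * (A * sinh (k * s) + B * cosh (k * s))" if "s \<in> J" for s
  proof -
    have "((\<lambda>s. A * cosh (k * s) + B * sinh (k * s)) has_real_derivative
        k * (A * sinh (k * s) + B * cosh (k * s))) (at s)"
      by (auto intro!: derivative_eq_intros simp: algebra_simps)
    then have "(f has_real_derivative k * (A * sinh (k * s) + B * cosh (k * s))) (at s)"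
      by (rule has_field_derivative_transform_within_open[OF _ J(1) that]) (simp add: f)
    then show ?thesis by (rule DERIV_imp_deriv)
  qed
  \<comment> \<open>Where \<open>g' = 0\<close>, differentiating \<open>f'\<^sup>2 + g'\<^sup>2 = 1\<close> gives \<open>f' f'' = 0\<close>, but \<open>f' = \<plusminus>1\<close> and
    \<open>f'' = k\<^sup>2 f \<noteq> 0\<close> there.\<close>
  have g1: "deriv g s \<noteq> 0" if s: "s \<in> J" for s
  proof
    assume g0: "deriv g s = 0"
    have "((\<lambda>x. (deriv f x)\<^sup>2 + (deriv g x)\<^sup>2) has_real_derivative
        2 * deriv f s * deriv (deriv f) s + 2 * deriv g s * deriv (deriv g) s) (at s)"
      by (auto intro!: derivative_eq_intros Df' Dg' s)
    moreover have "((\<lambda>x. (deriv f x)\<^sup>2 + (deriv g x)\<^sup>2) has_real_derivative 0) (at s)"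
      by (rule has_field_derivative_transform_within_open[OF DERIV_const J(1) s, of 1]) (simp add: unit)
    ultimately have "2 * deriv f s * deriv (deriv f) s + 2 * deriv g s * deriv (deriv g) s = 0"
      by (rule DERIV_unique)
    then show False
      using g0 unit[OF s] f2[OF s] f0[OF s] k(1) by simp
  qed
  obtain \<sigma> where \<sigma>: "\<sigma> \<in> {1, -1}" "\<And>s. s \<in> J \<Longrightarrow> deriv g s = \<sigma> * \<bar>deriv g s\<bar>"
    using nonzero_derivative_constant_sign[OF J(2) Dg g1] by blast
  have "\<bar>deriv g s\<bar> = sqrt (1 + K * (A * sinh (k * s) + B * cosh (k * s))\<^sup>2)" if "s \<in> J" for s
  proof -
    have "(deriv g s)\<^sup>2 = 1 + K * (A * sinh (k * s) + B * cosh (k * s))\<^sup>2"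
      using unit[OF that] k(2) unfolding f1[OF that] by (simp add: power_mult_distrib)
    then show ?thesis by (metis real_sqrt_abs)
  qed
  then show ?thesis
    unfolding k_def[symmetric] using \<sigma> f Dg by metis
qed

lemma loxodrome_components:
  assumes surf: "rotational_surface f g J" and lox: "loxodrome f g J I \<psi> \<alpha>"
  shows "\<exists>s \<theta> \<theta>'. \<forall>t\<in>I. s t \<in> J \<and> \<alpha> t = rotation_map f g (s t, \<theta> t) \<and>
    (s has_real_derivative cos \<psi>) (at t) \<and> (\<theta> has_real_derivative \<theta>' t) (at t) \<and>
    (\<theta>' t * f (s t))\<^sup>2 = (sin \<psi>)\<^sup>2"
proof -
  obtain s \<theta> where diff: "s differentiable_on I" "\<theta> differentiable_on I" and sJ: "s ` I \<subseteq> J"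
    and curve: "\<And>t. t \<in> I \<Longrightarrow> \<alpha> t = rotation_map f g (s t, \<theta> t)"
    and speed: "\<And>t. t \<in> I \<Longrightarrow> norm (vector_derivative \<alpha> (at t)) = 1"
    and angle: "\<And>t. t \<in> I \<Longrightarrow> vec_angle (vector_derivative \<alpha> (at t))
        (partial1 (rotation_map f g) (s t, \<theta> t)) = \<psi>"
    using lox unfolding loxodrome_def by blast
  have I: "open I" and J: "open J"
    using lox surf by (simp_all add: loxodrome_def rotational_surface_def)
  have "(s has_real_derivative cos \<psi>) (at t) \<and> (deriv \<theta> t * f (s t))\<^sup>2 = (sin \<psi>)\<^sup>2"
    if t: "t \<in> I" for t
  proof -
    define F F1 G1 S1 T1 where defs: "F = f (s t)" "F1 = deriv f (s t)" "G1 = deriv g (s t)"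
      "S1 = deriv s t" "T1 = deriv \<theta> t"
    define w z :: "real^3" where "w = vector [F1 * cos (\<theta> t), F1 * sin (\<theta> t), G1]"
      and "z = vector [F1 * S1 * cos (\<theta> t) - F * sin (\<theta> t) * T1,
        F1 * S1 * sin (\<theta> t) + F * cos (\<theta> t) * T1, G1 * S1]"
    have st: "s t \<in> J" using sJ t by blast
    have unit: "F1\<^sup>2 + G1\<^sup>2 = 1"
      using surf st by (simp add: rotational_surface_def defs)
    have cs: "(sin (\<theta> t))\<^sup>2 = 1 - (cos (\<theta> t))\<^sup>2"
      by (simp add: sin_squared_eq)
    have Ds: "(s has_real_derivative S1) (at t)" and DT: "(\<theta> has_real_derivative T1) (at t)"
      using diff I t by (auto simp: defs intro!: has_real_derivative_deriv_on_open)
    have "(f has_real_derivative F1) (at (s t))" "(g has_real_derivative G1) (at (s t))"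
      using surf st by (auto simp: defs rotational_surface_def intro!: has_real_derivative_deriv_on_open)
    then have Df: "((\<lambda>t. f (s t)) has_real_derivative F1 * S1) (at t)"
      and Dg: "((\<lambda>t. g (s t)) has_real_derivative G1 * S1) (at t)"
      using DERIV_chain2 Ds by blast+
    have "((\<lambda>t. vector [f (s t) * cos (\<theta> t), f (s t) * sin (\<theta> t), g (s t)] :: real^3)
        has_vector_derivative z) (at t)"
      unfolding z_def
      by (rule has_vector_derivative_vector_3)
        (auto intro!: derivative_eq_intros Df Dg DT simp: defs(1))
    then have "(\<alpha> has_vector_derivative z) (at t)"
      by (rule has_vector_derivative_transform_within_open[OF _ I t])
        (simp add: curve rotation_map_def)
    then have z: "vector_derivative \<alpha> (at t) = z"
      by (rule vector_derivative_at)
    have "w \<bullet> w = 1"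
      unfolding w_def inner_vec_def sum_3 using cs unit by (simp; algebra)
    then have w: "norm w = 1" by (simp add: norm_eq_sqrt_inner)
    have "z \<bullet> z = S1\<^sup>2 + (T1 * F)\<^sup>2"
      unfolding z_def inner_vec_def sum_3 using cs unit by (simp; algebra)
    moreover have "z \<bullet> z = 1"
      using speed[OF t] by (simp add: z norm_eq_sqrt_inner)
    ultimately have sum1: "S1\<^sup>2 + (T1 * F)\<^sup>2 = 1" by simp
    have "z \<bullet> w = S1"
      unfolding z_def w_def inner_vec_def sum_3 using cs unit by (simp; algebra)
    then have "arccos S1 = \<psi>"
      using angle[OF t] speed[OF t] w
      by (simp add: vec_angle_def partial_rotation_map(1)[OF surf st] defs(2,3)[symmetric]
          w_def[symmetric] z)
    moreover have "\<bar>S1\<bar> \<le> 1"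
      using sum1 by (metis abs_square_le_1 le_add_same_cancel1 zero_le_power2)
    ultimately have "S1 = cos \<psi>"
      using cos_arccos_abs[of S1] by simp
    then show ?thesis
      using Ds sum1 by (simp add: defs sin_squared_eq)
  qed
  moreover have "(\<theta> has_real_derivative deriv \<theta> t) (at t)" if "t \<in> I" for t
    using diff I that by (intro has_real_derivative_deriv_on_open)
  ultimately show ?thesis
    using curve sJ by blast
qed

lemma angle_function_eq_primitive:
  fixes F H P \<theta> \<theta>' :: "real \<Rightarrow> real"
  assumes I: "is_interval I" and a: "cos \<psi> \<noteq> 0"
    and D\<theta>: "\<And>t. t \<in> I \<Longrightarrow> (\<theta> has_real_derivative \<theta>' t) (at t)"
    and eq: "\<And>t. t \<in> I \<Longrightarrow> (\<theta>' t * F (cos \<psi> * t + c))\<^sup>2 = (sin \<psi>)\<^sup>2"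
    and nz: "\<And>t. t \<in> I \<Longrightarrow> F (cos \<psi> * t + c) \<noteq> 0"
    and H: "\<And>s. (H has_real_derivative F s) (at s)"
    and P: "\<And>s. F s \<noteq> 0 \<Longrightarrow> (P has_real_derivative \<eta> / F s) (at s)" and \<eta>: "\<eta> \<in> {1, -1}"
  shows "\<exists>\<epsilon>\<in>{1, -1}. \<exists>\<theta>\<^sub>0. \<forall>t\<in>I. \<theta> t = \<epsilon> * tan \<psi> * P (cos \<psi> * t + c) + \<theta>\<^sub>0"
proof -
  let ?s = "\<lambda>t. cos \<psi> * t + c"
  have Ds: "(?s has_real_derivative cos \<psi>) (at t)" for t
    by (auto intro!: derivative_eq_intros)
  have "\<exists>\<epsilon>\<in>{1, -1}. \<forall>t\<in>I. \<theta>' t = \<epsilon> * sin \<psi> * (\<eta> / F (?s t))"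
  proof (cases "sin \<psi> = 0")
    case True
    then show ?thesis using eq nz by auto
  next
    case False
    then have "\<theta>' t \<noteq> 0" if "t \<in> I" for t
      using eq[OF that] by auto
    from nonzero_derivative_constant_sign[OF I D\<theta> this]
    obtain \<epsilon>\<^sub>1 where e1: "\<epsilon>\<^sub>1 \<in> {1, -1}" "\<And>t. t \<in> I \<Longrightarrow> \<theta>' t = \<epsilon>\<^sub>1 * \<bar>\<theta>' t\<bar>"
      by blast
    have "((\<lambda>t. H (?s t) / cos \<psi>) has_real_derivative F (?s t)) (at t)" for t
      using DERIV_cdivide[OF DERIV_chain2[OF H Ds], of "cos \<psi>"] a by simp
    from nonzero_derivative_constant_sign[OF I this nz]
    obtain \<epsilon>\<^sub>2 where e2: "\<epsilon>\<^sub>2 \<in> {1, -1}" "\<And>t. t \<in> I \<Longrightarrow> F (?s t) = \<epsilon>\<^sub>2 * \<bar>F (?s t)\<bar>"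
      by blast
    define \<epsilon> where "\<epsilon> = \<epsilon>\<^sub>1 * \<epsilon>\<^sub>2 * sgn (sin \<psi>) * \<eta>"
    have "\<epsilon> \<in> {1, -1}"
      using e1(1) e2(1) \<eta> False by (auto simp: \<epsilon>_def sgn_if)
    moreover have "\<theta>' t = \<epsilon> * sin \<psi> * (\<eta> / F (?s t))" if t: "t \<in> I" for t
    proof -
      have "\<bar>\<theta>' t\<bar> * \<bar>F (?s t)\<bar> = \<bar>sin \<psi>\<bar>"
        using eq[OF t] by (metis abs_mult power2_eq_iff_nonneg abs_ge_zero power2_abs)
      then have "\<theta>' t * F (?s t) = \<epsilon>\<^sub>1 * \<epsilon>\<^sub>2 * \<bar>sin \<psi>\<bar>"
        using e1(2)[OF t] e2(2)[OF t] by (metis mult.assoc mult.left_commute)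
      also have "\<dots> = \<epsilon> * sin \<psi> * \<eta>"
        using \<eta> by (auto simp: \<epsilon>_def abs_sgn)
      finally show ?thesis
        using nz[OF t] by (simp add: eq_divide_eq)
    qed
    ultimately show ?thesis by blast
  qed
  then obtain \<epsilon> where \<epsilon>: "\<epsilon> \<in> {1, -1}" "\<And>t. t \<in> I \<Longrightarrow> \<theta>' t = \<epsilon> * sin \<psi> * (\<eta> / F (?s t))"
    by blast
  have "((\<lambda>t. \<theta> t - \<epsilon> * tan \<psi> * P (?s t)) has_real_derivative 0) (at t)" if t: "t \<in> I" for t
  proof -
    have "((\<lambda>t. \<theta> t - \<epsilon> * tan \<psi> * P (?s t)) has_real_derivative
        \<theta>' t - \<epsilon> * tan \<psi> * (\<eta> / F (?s t) * cos \<psi>)) (at t)"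
      by (intro DERIV_diff DERIV_cmult D\<theta>[OF t] DERIV_chain2[OF P[OF nz[OF t]] Ds])
    then show ?thesis
      using a by (simp add: \<epsilon>(2)[OF t] tan_def)
  qed
  then have "\<exists>\<theta>\<^sub>0. \<forall>t\<in>I. \<theta> t - \<epsilon> * tan \<psi> * P (?s t) = \<theta>\<^sub>0"
    using I by (intro has_field_derivative_zero_constant)
      (auto simp: is_interval_convex_1 intro: has_field_derivative_at_within)
  then obtain \<theta>\<^sub>0 where "\<And>t. t \<in> I \<Longrightarrow> \<theta> t - \<epsilon> * tan \<psi> * P (?s t) = \<theta>\<^sub>0"
    by blast
  then have "\<forall>t\<in>I. \<theta> t = \<epsilon> * tan \<psi> * P (?s t) + \<theta>\<^sub>0"
    by (simp add: algebra_simps)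
  then show ?thesis using \<epsilon>(1) by blast
qed

text \<open>The profile \<open>A = - B\<close>, a multiple of \<open>exp (- k s)\<close>, is turned into \<open>A = B\<close> by reversing
  the meridians.\<close>

lemma negative_curvature_profile_reflected:
  assumes surf: "rotational_surface f g J" and K: "K < 0"
    and curv: "\<forall>p \<in> J \<times> UNIV. gaussian_curvature (rotation_map f g) p = K"
  defines "k \<equiv> sqrt (- K)"
  shows "\<exists>A B. \<exists>\<sigma>\<in>{1, -1}. \<exists>\<delta>\<in>{1, -1}. (\<delta> = -1 \<longrightarrow> A = B) \<and> (A = B \<or> A\<^sup>2 \<noteq> B\<^sup>2) \<and>
    (\<forall>s. \<delta> * s \<in> J \<longrightarrow> f (\<delta> * s) = A * cosh (k * s) + B * sinh (k * s) \<and>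
      ((\<lambda>s. g (\<delta> * s)) has_real_derivative
        \<sigma> * sqrt (1 + K * (A * sinh (k * s) + B * cosh (k * s))\<^sup>2)) (at s))"
proof -
  obtain A B \<sigma> where \<sigma>: "\<sigma> \<in> {1, -1}"
    and fg: "\<forall>s\<in>J. f s = A * cosh (k * s) + B * sinh (k * s) \<and> (g has_real_derivative
      \<sigma> * sqrt (1 + K * (A * sinh (k * s) + B * cosh (k * s))\<^sup>2)) (at s)"
    using negative_curvature_profile[OF surf K curv] unfolding k_def[symmetric]
    by (elim exE bexE) (rule that)
  note f = fg[rule_format, THEN conjunct1] and g = fg[rule_format, THEN conjunct2]
  show ?thesis
  proof (cases "A = - B")
    case False
    then have "A = B \<or> A\<^sup>2 \<noteq> B\<^sup>2"
      by (simp add: power2_eq_iff)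
    then show ?thesis
      using \<sigma> f g by (intro exI[of _ A] exI[of _ B] bexI[of _ \<sigma>] bexI[of _ "1 :: real"]) auto
  next
    case True
    have "((\<lambda>s. g (- s)) has_real_derivative
        - \<sigma> * sqrt (1 + K * (A * sinh (k * s) + A * cosh (k * s))\<^sup>2)) (at s)" if "- s \<in> J" for s
    proof -
      have "(A * sinh (k * - s) + B * cosh (k * - s))\<^sup>2 = (A * sinh (k * s) + A * cosh (k * s))\<^sup>2"
        using True by (simp add: power2_eq_square algebra_simps)
      moreover have "(uminus has_real_derivative - 1) (at s)"
        by (auto intro!: derivative_eq_intros)
      from DERIV_chain2[where g = uminus, OF g[OF that] this]
      have "((\<lambda>s. g (- s)) has_real_derivative
        - \<sigma> * sqrt (1 + K * (A * sinh (k * - s) + B * cosh (k * - s))\<^sup>2)) (at s)"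
        by (rule DERIV_cong) (simp only: mult_minus1_right mult_minus_left)
      ultimately show ?thesis
        by (simp only:)
    qed
    moreover have "f (- s) = A * cosh (k * s) + A * sinh (k * s)" if "- s \<in> J" for s
      using f[OF that] True by simp
    ultimately show ?thesis
      using \<sigma> by (intro exI[of _ A] bexI[of _ "- \<sigma>"] bexI[of _ "- 1 :: real"]) auto
  qed
qed

text \<open>\<open>\<Phi>\<close> is the height integral, whose base point \<open>0\<close> may lie outside \<open>J\<close>.\<close>

lemma height_constant_zero:
  fixes g \<Phi> :: "real \<Rightarrow> real"
  assumes J: "open J" "0 \<in> closure J" and lim: "(g \<longlongrightarrow> 0) (at 0 within J)"
    and \<Phi>: "isCont \<Phi> 0" "\<Phi> 0 = 0" and g: "\<And>s. s \<in> J \<Longrightarrow> g s = \<Phi> s + z"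
  shows "z = 0"
proof -
  have "0 islimpt J"
    using J interior_limit_point[of 0 J] by (auto simp: closure_def interior_open)
  then have nt: "at 0 within J \<noteq> bot"
    by (simp add: trivial_limit_within)
  have "((\<lambda>s. \<Phi> s + z) \<longlongrightarrow> \<Phi> 0 + z) (at 0 within J)"
    using \<Phi>(1) by (intro tendsto_add tendsto_const) (auto simp: isCont_def intro: tendsto_within_subset)
  then have "(g \<longlongrightarrow> \<Phi> 0 + z) (at 0 within J)"
    by (rule Lim_transform_eventually) (simp add: eventually_at_filter g)
  then show ?thesis
    using tendsto_unique[OF nt lim] \<Phi>(2) by simp
qed

lemma reciprocal_primitive_cases:
  fixes A B k :: real
  assumes k: "k > 0" and AB: "A = B \<or> A\<^sup>2 \<noteq> B\<^sup>2" "A \<noteq> 0 \<or> B \<noteq> 0"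
  shows "\<exists>P. \<exists>\<eta>\<in>{1, -1}.
    (\<forall>s. A * cosh (k * s) + B * sinh (k * s) \<noteq> 0 \<longrightarrow>
       (P has_real_derivative \<eta> / (A * cosh (k * s) + B * sinh (k * s))) (at s)) \<and>
    (A = 0 \<and> B \<noteq> 0 \<and> P = (\<lambda>s. 1 / (B * k) * ln \<bar>tanh (1 / 2 * (k * s))\<bar>) \<or>
     A \<noteq> 0 \<and> B\<^sup>2 < A\<^sup>2 \<and> P = (\<lambda>s. 2 / (k * sqrt (A\<^sup>2 - B\<^sup>2)) *
       arctan (1 / sqrt (A\<^sup>2 - B\<^sup>2) * (A * tanh (1 / 2 * (k * s)) + B))) \<or>
     B \<noteq> 0 \<and> A\<^sup>2 < B\<^sup>2 \<and> P = (\<lambda>s. 2 / (k * sqrt (B\<^sup>2 - A\<^sup>2)) *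
       artanh (1 / sqrt (B\<^sup>2 - A\<^sup>2) * (A * tanh (1 / 2 * (k * s)) + B))) \<or>
     A = B \<and> B \<noteq> 0 \<and> P = (\<lambda>s. - (1 / (A * k)) * exp (- (k * s))))"
proof -
  consider "A = 0" "B \<noteq> 0" | "A \<noteq> 0" "B\<^sup>2 < A\<^sup>2" | "A \<noteq> 0" "B \<noteq> 0" "A\<^sup>2 < B\<^sup>2" | "A = B" "B \<noteq> 0"
    using AB by (metis linorder_neqE_linordered_idom power_zero_numeral zero_less_power2 order_less_asym)
  then show ?thesis
  proof cases
    case 1
    let ?P = "\<lambda>s. 1 / (B * k) * ln \<bar>tanh (1 / 2 * (k * s))\<bar>"
    have "\<forall>s. A * cosh (k * s) + B * sinh (k * s) \<noteq> 0 \<longrightarrow>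
        (?P has_real_derivative 1 / (A * cosh (k * s) + B * sinh (k * s))) (at s)"
      using primitive_recip_sinh[of k B] 1 k by (simp only: mult_zero_left add_0) auto
    then show ?thesis
      using 1 by (intro exI[of _ ?P] bexI[of _ "1"] conjI; (assumption | simp))
  next
    case 2
    let ?P = "\<lambda>s. 2 / (k * sqrt (A\<^sup>2 - B\<^sup>2)) *
       arctan (1 / sqrt (A\<^sup>2 - B\<^sup>2) * (A * tanh (1 / 2 * (k * s)) + B))"
    have "\<forall>s. A * cosh (k * s) + B * sinh (k * s) \<noteq> 0 \<longrightarrow>
        (?P has_real_derivative 1 / (A * cosh (k * s) + B * sinh (k * s))) (at s)"
      using primitive_recip_arctan[of k B A] 2 k by (metis less_irrefl)
    then show ?thesis
      using 2 by (intro exI[of _ ?P] bexI[of _ "1"] conjI; (assumption | simp))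
  next
    case 3
    let ?P = "\<lambda>s. 2 / (k * sqrt (B\<^sup>2 - A\<^sup>2)) *
       artanh (1 / sqrt (B\<^sup>2 - A\<^sup>2) * (A * tanh (1 / 2 * (k * s)) + B))"
    have "\<forall>s. A * cosh (k * s) + B * sinh (k * s) \<noteq> 0 \<longrightarrow>
        (?P has_real_derivative - 1 / (A * cosh (k * s) + B * sinh (k * s))) (at s)"
      using primitive_recip_artanh[of k A B] 3 k by (metis less_irrefl)
    then show ?thesis
      using 3 by (intro exI[of _ ?P] bexI[of _ "- 1"] conjI; (assumption | simp))
  next
    case 4
    let ?P = "\<lambda>s. - (1 / (A * k)) * exp (- (k * s))"
    have "\<forall>s. A * cosh (k * s) + B * sinh (k * s) \<noteq> 0 \<longrightarrow>
        (?P has_real_derivative 1 / (A * cosh (k * s) + B * sinh (k * s))) (at s)"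
      using primitive_recip_exp[of k A] 4 k by (auto simp del: times_divide_eq_left times_divide_eq_right)
    then show ?thesis
      using 4 by (intro exI[of _ ?P] bexI[of _ "1"] conjI; (assumption | simp))
  qed
qed

theorem theorem7:
  fixes f g :: "real \<Rightarrow> real" and J I :: "real set" and K\<^sub>0 \<psi> :: real and \<alpha> :: "real \<Rightarrow> real^3"
  assumes "rotational_surface f g J"
    and "K\<^sub>0 < 0"
    and "\<forall>p \<in> J \<times> UNIV. gaussian_curvature (rotation_map f g) p = K\<^sub>0"
    and "loxodrome f g J I \<psi> \<alpha>"
    and "\<psi> \<noteq> pi / 2"
  shows "\<exists>(A::real) (B::real) (c::real) (a\<^sub>0::real) (\<theta>\<^sub>0::real) (z\<^sub>0::real)
           (\<epsilon>::real) (\<sigma>::real) (\<delta>::real) (a::real) (\<theta>::real \<Rightarrow> real).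
     a = cos \<psi> \<and> a\<^sub>0 = c * sqrt (- K\<^sub>0) \<and>
     \<epsilon> \<in> {1, -1} \<and> \<sigma> \<in> {1, -1} \<and> \<delta> \<in> {1, -1} \<and> (\<delta> = -1 \<longrightarrow> A = B) \<and>
     (0 \<in> closure J \<and> (g \<longlongrightarrow> 0) (at 0 within J) \<longrightarrow> z\<^sub>0 = 0) \<and>
     (\<forall>s. \<delta> * s \<in> J \<longrightarrow> f (\<delta> * s) = A * cosh (sqrt (- K\<^sub>0) * s) + B * sinh (sqrt (- K\<^sub>0) * s)) \<and>
     (\<forall>t. \<delta> * t \<in> I \<longrightarrow> \<alpha> (\<delta> * t) =
        vector
         [(A * cosh (a * sqrt (- K\<^sub>0) * t + a\<^sub>0) + B * sinh (a * sqrt (- K\<^sub>0) * t + a\<^sub>0)) * cos (\<theta> t),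
          (A * cosh (a * sqrt (- K\<^sub>0) * t + a\<^sub>0) + B * sinh (a * sqrt (- K\<^sub>0) * t + a\<^sub>0)) * sin (\<theta> t),
          \<sigma> * (LBINT \<xi>=0..a * t + c.
                 sqrt (1 + K\<^sub>0 * (A * sinh (sqrt (- K\<^sub>0) * \<xi>) + B * cosh (sqrt (- K\<^sub>0) * \<xi>))\<^sup>2)) + z\<^sub>0]) \<and>
     ((A = 0 \<and> B \<noteq> 0 \<and>
        (\<forall>t. \<delta> * t \<in> I \<longrightarrow> \<theta> t =
           \<epsilon> * tan \<psi> / (B * sqrt (- K\<^sub>0)) * ln \<bar>tanh (1 / 2 * (a * sqrt (- K\<^sub>0) * t + a\<^sub>0))\<bar> + \<theta>\<^sub>0)) \<or>
      (A \<noteq> 0 \<and> B\<^sup>2 < A\<^sup>2 \<and>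
        (\<forall>t. \<delta> * t \<in> I \<longrightarrow> \<theta> t =
           2 * \<epsilon> * tan \<psi> / sqrt (K\<^sub>0 * (B\<^sup>2 - A\<^sup>2)) *
             arctan (1 / sqrt (A\<^sup>2 - B\<^sup>2) * (A * tanh (1 / 2 * (a * sqrt (- K\<^sub>0) * t + a\<^sub>0)) + B)) + \<theta>\<^sub>0)) \<or>
      (B \<noteq> 0 \<and> A\<^sup>2 < B\<^sup>2 \<and>
        (\<forall>t. \<delta> * t \<in> I \<longrightarrow> \<theta> t =
           2 * \<epsilon> * tan \<psi> / sqrt (K\<^sub>0 * (A\<^sup>2 - B\<^sup>2)) *
             artanh (1 / sqrt (B\<^sup>2 - A\<^sup>2) * (A * tanh (1 / 2 * (a * sqrt (- K\<^sub>0) * t + a\<^sub>0)) + B)) + \<theta>\<^sub>0)) \<or>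
      (A = B \<and> B \<noteq> 0 \<and>
        (\<forall>t. \<delta> * t \<in> I \<longrightarrow> \<theta> t =
           - (\<epsilon> * tan \<psi> / (A * sqrt (- K\<^sub>0))) * exp (- (a * sqrt (- K\<^sub>0) * t + a\<^sub>0)) + \<theta>\<^sub>0)))"
proof -
  define k a where "k = sqrt (- K\<^sub>0)" and "a = cos \<psi>"
  have k: "k > 0" using assms(2) by (simp add: k_def)
  have J: "open J" and I: "open I" "is_interval I" "I \<noteq> {}" and \<psi>: "0 \<le> \<psi>" "\<psi> \<le> pi"
    using assms(1,4) by (simp_all add: rotational_surface_def loxodrome_def)
  have a: "cos \<psi> \<noteq> 0"
  proof
    assume "cos \<psi> = 0"
    then have "arccos (cos \<psi>) = pi / 2" by simp
    then show False using \<psi> assms(5) arccos_cos by metis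
  qed
  obtain A B \<sigma> \<delta> where \<sigma>: "\<sigma> \<in> {1, -1}" and \<delta>: "\<delta> \<in> {1, -1}"
    and form: "(\<delta> = -1 \<longrightarrow> A = B) \<and> (A = B \<or> A\<^sup>2 \<noteq> B\<^sup>2) \<and>
      (\<forall>s. \<delta> * s \<in> J \<longrightarrow> f (\<delta> * s) = A * cosh (k * s) + B * sinh (k * s) \<and>
        ((\<lambda>s. g (\<delta> * s)) has_real_derivative
          \<sigma> * sqrt (1 + K\<^sub>0 * (A * sinh (k * s) + B * cosh (k * s))\<^sup>2)) (at s))"
    using negative_curvature_profile_reflected[OF assms(1-3)] unfolding k_def[symmetric]
    by (elim exE bexE) (rule that)
  from form have \<delta>AB: "\<delta> = -1 \<longrightarrow> A = B" and AB: "A = B \<or> A\<^sup>2 \<noteq> B\<^sup>2"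
    and f: "\<And>s. \<delta> * s \<in> J \<Longrightarrow> f (\<delta> * s) = A * cosh (k * s) + B * sinh (k * s)"
    and g: "\<And>s. \<delta> * s \<in> J \<Longrightarrow> ((\<lambda>s. g (\<delta> * s)) has_real_derivative
        \<sigma> * sqrt (1 + K\<^sub>0 * (A * sinh (k * s) + B * cosh (k * s))\<^sup>2)) (at s)"
    by simp_all
  obtain s \<theta> \<theta>' where comps: "\<forall>t\<in>I. s t \<in> J \<and> \<alpha> t = rotation_map f g (s t, \<theta> t) \<and>
      (s has_real_derivative cos \<psi>) (at t) \<and> (\<theta> has_real_derivative \<theta>' t) (at t) \<and>
      (\<theta>' t * f (s t))\<^sup>2 = (sin \<psi>)\<^sup>2"
    using loxodrome_components[OF assms(1,4)] by (elim exE) (rule that)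
  then have sJ: "\<And>t. t \<in> I \<Longrightarrow> s t \<in> J"
    and curve: "\<And>t. t \<in> I \<Longrightarrow> \<alpha> t = rotation_map f g (s t, \<theta> t)"
    and Ds: "\<And>t. t \<in> I \<Longrightarrow> (s has_real_derivative cos \<psi>) (at t)"
    and D\<theta>: "\<And>t. t \<in> I \<Longrightarrow> (\<theta> has_real_derivative \<theta>' t) (at t)"
    and eq: "\<And>t. t \<in> I \<Longrightarrow> (\<theta>' t * f (s t))\<^sup>2 = (sin \<psi>)\<^sup>2"
    by simp_all
  have \<delta>\<delta>: "\<delta> * (\<delta> * x) = x" for x
    using \<delta> by auto
  have interval: "is_interval {x. \<delta> * x \<in> S}" if "is_interval S" for S
    unfolding is_interval_1
  proof (intro ballI allI impI, elim conjE)
    fix p q r assume "p \<in> {x. \<delta> * x \<in> S}" "q \<in> {x. \<delta> * x \<in> S}" "p \<le> r" "r \<le> q"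
    then show "r \<in> {x. \<delta> * x \<in> S}"
      using \<delta> mem_is_interval_1_I[OF that, of "\<delta> * p" "\<delta> * q" "\<delta> * r"]
        mem_is_interval_1_I[OF that, of "\<delta> * q" "\<delta> * p" "\<delta> * r"] by auto
  qed
  define I' where "I' = {t. \<delta> * t \<in> I}"
  have I': "is_interval I'"
    using I(2) by (simp add: I'_def interval)
  have D\<delta>: "((\<lambda>t. \<delta> * t) has_real_derivative \<delta>) (at t)" for t
    by (auto intro!: derivative_eq_intros)

  have "((\<lambda>t. \<delta> * s (\<delta> * t) - cos \<psi> * t) has_real_derivative 0) (at t)" if "t \<in> I'" for t
  proof -
    have "\<delta> * t \<in> I" using that by (simp add: I'_def)
    then have "((\<lambda>t. \<delta> * s (\<delta> * t) - cos \<psi> * t) has_real_derivative \<delta> * (cos \<psi> * \<delta>) - cos \<psi> * 1) (at t)"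
      by (intro DERIV_diff DERIV_cmult DERIV_chain2[OF Ds D\<delta>] DERIV_ident)
    then show ?thesis using \<delta>\<delta>[of "cos \<psi>"] by (simp add: mult.commute)
  qed
  then have "\<exists>c. \<forall>t\<in>I'. \<delta> * s (\<delta> * t) - cos \<psi> * t = c"
    using I' by (intro has_field_derivative_zero_constant)
      (auto simp: is_interval_convex_1 intro: has_field_derivative_at_within)
  then obtain c where "\<And>t. t \<in> I' \<Longrightarrow> \<delta> * s (\<delta> * t) - cos \<psi> * t = c" by blast
  then have c: "s (\<delta> * t) = \<delta> * (cos \<psi> * t + c)" if "t \<in> I'" for t
    using that \<delta>\<delta> by (metis add.commute diff_add_cancel)
  have cJ: "\<delta> * (cos \<psi> * t + c) \<in> J" if "t \<in> I'" for t
    using c[OF that] sJ[of "\<delta> * t"] that by (simp add: I'_def)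

  define h \<Phi> where "h = (\<lambda>\<xi>. sqrt (1 + K\<^sub>0 * (A * sinh (k * \<xi>) + B * cosh (k * \<xi>))\<^sup>2))"
    and "\<Phi> = (\<lambda>u::real. LBINT \<xi>=0..u. h \<xi>)"
  have "continuous_on UNIV h"
    unfolding h_def by (intro continuous_intros)
  then have D\<Phi>: "(\<Phi> has_real_derivative h x) (at x)" for x
    unfolding \<Phi>_def by (rule interval_integral_derivative)
  have "\<exists>z. \<forall>x\<in>{x. \<delta> * x \<in> J}. g (\<delta> * x) - \<sigma> * \<Phi> x = z"
  proof (rule has_field_derivative_zero_constant)
    show "convex {x. \<delta> * x \<in> J}"
      using interval[of J] assms(1) by (simp add: is_interval_convex_1 rotational_surface_def)
    fix x assume "x \<in> {x. \<delta> * x \<in> J}"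
    then have "((\<lambda>x. g (\<delta> * x) - \<sigma> * \<Phi> x) has_real_derivative \<sigma> * h x - \<sigma> * h x) (at x)"
      using g by (intro DERIV_diff DERIV_cmult D\<Phi>) (simp add: h_def)
    then show "((\<lambda>x. g (\<delta> * x) - \<sigma> * \<Phi> x) has_real_derivative 0) (at x within {x. \<delta> * x \<in> J})"
      by (simp add: has_field_derivative_at_within)
  qed
  then obtain z where z: "\<And>x. \<delta> * x \<in> J \<Longrightarrow> g (\<delta> * x) = \<sigma> * \<Phi> x + z"
    by (auto simp: algebra_simps)
  have z0: "z = 0" if "0 \<in> closure J" "(g \<longlongrightarrow> 0) (at 0 within J)"
  proof (rule height_constant_zero[OF J that])
    show "isCont (\<lambda>x. \<sigma> * \<Phi> (\<delta> * x)) 0"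
      using DERIV_isCont[OF DERIV_cmult[OF DERIV_chain2[OF D\<Phi> D\<delta>]]] .
    show "\<sigma> * \<Phi> (\<delta> * 0) = 0" by (simp add: \<Phi>_def zero_ereal_def[symmetric])
    show "g x = \<sigma> * \<Phi> (\<delta> * x) + z" if "x \<in> J" for x
      using z[of "\<delta> * x"] that by (simp add: \<delta>\<delta>)
  qed

  define F where "F = (\<lambda>x. A * cosh (k * x) + B * sinh (k * x))"
  have F0: "F (cos \<psi> * t + c) \<noteq> 0" if "t \<in> I'" for t
    using rotational_surface_radius_nonzero[OF assms(1) cJ[OF that]] f[OF cJ[OF that]]
    by (simp add: F_def)
  obtain t\<^sub>0 where "t\<^sub>0 \<in> I'"
    using I(3) \<delta>\<delta> unfolding I'_def by (metis ex_in_conv mem_Collect_eq)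
  then have "A \<noteq> 0 \<or> B \<noteq> 0"
    using F0 by (auto simp: F_def)
  from reciprocal_primitive_cases[OF k AB this]
  obtain P \<eta> where \<eta>: "\<eta> \<in> {1, -1}"
    and DP': "\<forall>x. F x \<noteq> 0 \<longrightarrow> (P has_real_derivative \<eta> / F x) (at x)"
    and P: "A = 0 \<and> B \<noteq> 0 \<and> P = (\<lambda>s. 1 / (B * k) * ln \<bar>tanh (1 / 2 * (k * s))\<bar>) \<or>
     A \<noteq> 0 \<and> B\<^sup>2 < A\<^sup>2 \<and> P = (\<lambda>s. 2 / (k * sqrt (A\<^sup>2 - B\<^sup>2)) *
       arctan (1 / sqrt (A\<^sup>2 - B\<^sup>2) * (A * tanh (1 / 2 * (k * s)) + B))) \<or>
     B \<noteq> 0 \<and> A\<^sup>2 < B\<^sup>2 \<and> P = (\<lambda>s. 2 / (k * sqrt (B\<^sup>2 - A\<^sup>2)) *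
       artanh (1 / sqrt (B\<^sup>2 - A\<^sup>2) * (A * tanh (1 / 2 * (k * s)) + B))) \<or>
     A = B \<and> B \<noteq> 0 \<and> P = (\<lambda>s. - (1 / (A * k)) * exp (- (k * s)))"
    by (elim exE bexE conjE) (erule that, unfold F_def, assumption+)
  note DP = DP'[rule_format]
  have "\<exists>\<epsilon>\<in>{1, -1}. \<exists>\<theta>\<^sub>0. \<forall>t\<in>I'. \<theta> (\<delta> * t) = \<epsilon> * tan \<psi> * P (cos \<psi> * t + c) + \<theta>\<^sub>0"
  proof (rule angle_function_eq_primitive[OF I' a _ _ F0 _ DP \<eta>])
    fix t assume t: "t \<in> I'"
    then have tI: "\<delta> * t \<in> I" by (simp add: I'_def)
    show "((\<lambda>t. \<theta> (\<delta> * t)) has_real_derivative \<theta>' (\<delta> * t) * \<delta>) (at t)"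
      using DERIV_chain2[OF D\<theta>[OF tI] D\<delta>] .
    show "(\<theta>' (\<delta> * t) * \<delta> * F (cos \<psi> * t + c))\<^sup>2 = (sin \<psi>)\<^sup>2"
      using eq[OF tI] f[OF cJ[OF t]] \<delta> by (auto simp: c[OF t] F_def power_mult_distrib)
  next
    show "((\<lambda>x. (A * sinh (k * x) + B * cosh (k * x)) / k) has_real_derivative F x) (at x)" for x
      unfolding F_def using k by (auto intro!: derivative_eq_intros simp: field_simps)
  qed
  then obtain \<epsilon> \<theta>\<^sub>0 where \<epsilon>: "\<epsilon> \<in> {1, -1}"
    and \<theta>: "\<And>t. t \<in> I' \<Longrightarrow> \<theta> (\<delta> * t) = \<epsilon> * tan \<psi> * P (cos \<psi> * t + c) + \<theta>\<^sub>0"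
    by blast
  have arg: "cos \<psi> * k * t + c * k = k * (cos \<psi> * t + c)" for t
    by (simp add: algebra_simps)
  have roots: "sqrt (K\<^sub>0 * (B\<^sup>2 - A\<^sup>2)) = k * sqrt (A\<^sup>2 - B\<^sup>2)" "sqrt (K\<^sub>0 * (A\<^sup>2 - B\<^sup>2)) = k * sqrt (B\<^sup>2 - A\<^sup>2)"
    unfolding k_def real_sqrt_mult[symmetric] by (simp_all add: algebra_simps)
  have \<alpha>: "\<forall>t. \<delta> * t \<in> I \<longrightarrow> \<alpha> (\<delta> * t) =
      vector
       [(A * cosh (k * (cos \<psi> * t + c)) + B * sinh (k * (cos \<psi> * t + c))) * cos (\<theta> (\<delta> * t)),
        (A * cosh (k * (cos \<psi> * t + c)) + B * sinh (k * (cos \<psi> * t + c))) * sin (\<theta> (\<delta> * t)),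
        \<sigma> * (LBINT \<xi>=0..cos \<psi> * t + c. sqrt (1 + K\<^sub>0 * (A * sinh (k * \<xi>) + B * cosh (k * \<xi>))\<^sup>2)) + z]"
  proof (intro allI impI)
    fix t assume tI: "\<delta> * t \<in> I"
    then have t: "t \<in> I'" by (simp add: I'_def)
    have "\<alpha> (\<delta> * t) = vector [F (cos \<psi> * t + c) * cos (\<theta> (\<delta> * t)),
        F (cos \<psi> * t + c) * sin (\<theta> (\<delta> * t)), \<sigma> * \<Phi> (cos \<psi> * t + c) + z]"
      unfolding curve[OF tI] c[OF t] rotation_map_def prod.case f[OF cJ[OF t]] z[OF cJ[OF t]] F_def ..
    then show "\<alpha> (\<delta> * t) = vector
       [(A * cosh (k * (cos \<psi> * t + c)) + B * sinh (k * (cos \<psi> * t + c))) * cos (\<theta> (\<delta> * t)),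
        (A * cosh (k * (cos \<psi> * t + c)) + B * sinh (k * (cos \<psi> * t + c))) * sin (\<theta> (\<delta> * t)),
        \<sigma> * (LBINT \<xi>=0..cos \<psi> * t + c. sqrt (1 + K\<^sub>0 * (A * sinh (k * \<xi>) + B * cosh (k * \<xi>))\<^sup>2)) + z]"
      unfolding F_def \<Phi>_def h_def .
  qed
  have \<theta>': "\<forall>t. \<delta> * t \<in> I \<longrightarrow> \<theta> (\<delta> * t) = \<epsilon> * tan \<psi> * P (cos \<psi> * t + c) + \<theta>\<^sub>0"
    using \<theta> by (simp add: I'_def)
  show ?thesis
  proof (rule exI[of _ A], rule exI[of _ B], rule exI[of _ c], rule exI[of _ "c * k"], rule exI[of _ \<theta>\<^sub>0],
      rule exI[of _ z], rule exI[of _ \<epsilon>], rule exI[of _ \<sigma>], rule exI[of _ \<delta>], rule exI[of _ "cos \<psi>"],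
      rule exI[of _ "\<lambda>t. \<theta> (\<delta> * t)"], unfold k_def[symmetric] arg roots,
      intro conjI \<epsilon> \<sigma> \<delta> \<delta>AB refl \<alpha>, goal_cases)
    case 1
    then show ?case using z0 by blast
  next
    case 2
    then show ?case using f by blast
  next
    case 3
    from P show ?case
      by (elim disjE conjE) (simp_all add: \<theta>')
  qed
qed

end
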